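(* Let $P$ be a positive integer and let $0<b\le 1$ with $b\le 1/P^2$. Then the Stokes wave solution $\phi(x)=\sqrt b\,e^{ix\sqrt{1-b}}$ of the focusing NLS equation is spectrally stable with respect to perturbations of period $P\pi$: if $\lambda\in\mathbb C$ and $(U,V)\neq(0,0)$ satisfies $\mathcal L(U,V)^T=\lambda(U,V)^T$ and $(U,V)(x+P\pi)=(U,V)(x)$ for all $x$, then $\operatorname{Re}\lambda=0$.
   Context: The focusing NLS equation is $i\Psi_t+\tfrac12\Psi_{xx}+\Psi|\Psi|^2=0$, with stationary solutions $\Psi=e^{-i\omega t}\phi(x)$. For the Stokes wave, $\omega=\tfrac12-\tfrac32b$, and $\phi=Re^{i\theta}$ with constant $R=\sqrt b$, $\theta(x)=x\sqrt{1-b}$. Writing $\Psi=e^{-i\omega t}e^{i\theta(x)}(R+\epsilon(u+iv)+\dots)$, the linearization is $\partial_t(u,v)^T=\mathcal L(u,v)^T$ with $$\mathcal L=\begin{pmatrix}-S&\mathcal L_-\\-\mathcal L_+&-S\end{pmatrix},\quad \mathcal L_-=-\tfrac12\partial_x^2-R^2-\omega+\frac{c^2}{2R^4},\quad \mathcal L_+=-\tfrac12\partial_x^2-3R^2-\omega+\frac{c^2}{2R^4},\quad S=\frac{c}{R^2}\partial_x,\quad c=b\sqrt{1-b}.$$ $U,V$ are complex-valued. The Stokes waves are the case $k=0$ of the elliptic solutions, whose fundamental period is $T=2K(0)=\pi$. *)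

theory Defs
  imports "HOL-Analysis.Analysis"
begin

abbreviation D :: "(real \<Rightarrow> complex) \<Rightarrow> real \<Rightarrow> complex" where
  "D f \<equiv> (\<lambda>x. vector_derivative f (at x))"

definition twice_differentiable :: "(real \<Rightarrow> complex) \<Rightarrow> bool" where
  "twice_differentiable f \<longleftrightarrow>
     (\<forall>x. f differentiable (at x)) \<and> (\<forall>x. D f differentiable (at x))"

text \<open>The focusing NLS equation; the arguments of \<open>\<Psi>\<close> are time and space, in this order.\<close>

definition nls_solution :: "(real \<Rightarrow> real \<Rightarrow> complex) \<Rightarrow> bool" where
  "nls_solution \<Psi> \<longleftrightarrow>
     (\<forall>x t. (\<lambda>s. \<Psi> s x) differentiable (at t)) \<and>
     (\<forall>t. twice_differentiable (\<Psi> t)) \<and>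
     (\<forall>t x. \<i> * D (\<lambda>s. \<Psi> s x) t + 1/2 * D (D (\<Psi> t)) x
              + \<Psi> t x * of_real ((cmod (\<Psi> t x))\<^sup>2) = 0)"

definition stokes_R :: "real \<Rightarrow> real" where
  "stokes_R b = sqrt b"

definition stokes_theta :: "real \<Rightarrow> real \<Rightarrow> real" where
  "stokes_theta b x = x * sqrt (1 - b)"

definition stokes_omega :: "real \<Rightarrow> real" where
  "stokes_omega b = 1/2 - 3/2 * b"

definition stokes_c :: "real \<Rightarrow> real" where
  "stokes_c b = b * sqrt (1 - b)"

definition stokes_wave :: "real \<Rightarrow> real \<Rightarrow> complex" where
  "stokes_wave b x = of_real (stokes_R b) * exp (\<i> * of_real (stokes_theta b x))"

lemma D_const_exp:
  "((\<lambda>x. A * exp (\<i> * of_real (k * x + d))) has_vector_derivative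
      \<i> * of_real k * A * exp (\<i> * of_real (k * x + d))) (at x)"
  by (auto intro!: derivative_eq_intros has_vector_derivative_real_field
      simp: algebra_simps)

lemma stokes_wave_solution:
  assumes "0 \<le> b" "b \<le> 1"
  shows "nls_solution (\<lambda>t x. exp (- \<i> * of_real (stokes_omega b * t)) * stokes_wave b x)"
proof -
  define k where "k = sqrt (1 - b)"
  have k2: "k * k = 1 - b" using assms by (simp add: k_def)
  define w where "w = stokes_omega b"
  define P where "P = (\<lambda>t x::real. exp (- \<i> * of_real (w * t)) * stokes_wave b x)"
  have P: "P t x = of_real (sqrt b) * exp (\<i> * of_real (k * x + (- w) * t))" for t x
    by (simp add: P_def stokes_wave_def stokes_theta_def stokes_R_def k_def exp_add [symmetric] algebra_simps
        flip: exp_add)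
  have Px: "(P t has_vector_derivative \<i> * of_real k * P t x) (at x)" for t x
    using D_const_exp[of "of_real (sqrt b)" k "(- w) * t" x]
    by (simp add: P[abs_def] mult.assoc)
  have Pt: "((\<lambda>s. P s x) has_vector_derivative - \<i> * of_real w * P t x) (at t)" for t x
    using D_const_exp[of "of_real (sqrt b)" "- w" "k * x" t]
    by (simp add: P[abs_def] mult.assoc add.commute)
  have DP: "D (P t) = (\<lambda>x. \<i> * of_real k * P t x)" for t
    using Px by (auto intro!: vector_derivative_at)
  have Pxx: "(D (P t) has_vector_derivative \<i> * of_real k * (\<i> * of_real k * P t x)) (at x)" for t x
    unfolding DP by (intro has_vector_derivative_mult_right Px)
  have n: "(cmod (P t x))\<^sup>2 = b" for t x
    using assms by (simp add: P norm_mult)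
  have eq: "\<i> * D (\<lambda>s. P s x) t + 1/2 * D (D (P t)) x + P t x * of_real ((cmod (P t x))\<^sup>2) = 0" for t x
  proof -
    have "\<i> * D (\<lambda>s. P s x) t + 1/2 * D (D (P t)) x + P t x * of_real ((cmod (P t x))\<^sup>2)
       = of_real (w - (k * k) / 2 + b) * P t x"
      unfolding vector_derivative_at[OF Pt] vector_derivative_at[OF Pxx] n
      by (simp add: algebra_simps)
    also have "w - (k * k) / 2 + b = 0" by (simp add: k2 w_def stokes_omega_def field_simps)
    finally show ?thesis by simp
  qed
  have "nls_solution P"
    unfolding nls_solution_def twice_differentiable_def
    using differentiableI_vector[OF Px] differentiableI_vector[OF Pt] differentiableI_vector[OF Pxx] eq
    by blast
  then show ?thesis by (simp add: P_def w_def)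
qed

text \<open>
  The linearization about \<open>\<Psi> = exp (- \<i> \<omega> t) R exp (\<i> \<theta>)\<close> with constant amplitude \<open>R\<close>, in
  the unknowns \<open>u, v\<close> of the perturbed solution
  \<open>exp (- \<i> \<omega> t) exp (\<i> \<theta>) (R + \<epsilon> (u + \<i> v))\<close>.
  The constant \<open>c\<close> is \<open>R\<^sup>2 \<theta>'\<close>.
\<close>

definition L_minus :: "real \<Rightarrow> real \<Rightarrow> real \<Rightarrow> (real \<Rightarrow> complex) \<Rightarrow> real \<Rightarrow> complex" where
  "L_minus R \<omega> c f x =
     - (1/2 * D (D f) x) + of_real (- (R^2) - \<omega> + c^2 / (2 * R^4)) * f x"

definition L_plus :: "real \<Rightarrow> real \<Rightarrow> real \<Rightarrow> (real \<Rightarrow> complex) \<Rightarrow> real \<Rightarrow> complex" where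
  "L_plus R \<omega> c f x =
     - (1/2 * D (D f) x) + of_real (- (3 * R^2) - \<omega> + c^2 / (2 * R^4)) * f x"

definition S_op :: "real \<Rightarrow> real \<Rightarrow> (real \<Rightarrow> complex) \<Rightarrow> real \<Rightarrow> complex" where
  "S_op R c f x = of_real (c / R^2) * D f x"

definition lin_op :: "real \<Rightarrow> real \<Rightarrow> real \<Rightarrow>
    (real \<Rightarrow> complex) \<times> (real \<Rightarrow> complex) \<Rightarrow> (real \<Rightarrow> complex) \<times> (real \<Rightarrow> complex)" where
  "lin_op R \<omega> c = (\<lambda>(U, V).
     (\<lambda>x. - S_op R c U x + L_minus R \<omega> c V x,
      \<lambda>x. - L_plus R \<omega> c U x - S_op R c V x))"

text \<open>
  Eigenfunctions are classical. Requiring only that \<open>U\<close> and \<open>V\<close> are twice differentiable loses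
  nothing: the eigenvalue equation then makes them smooth. The period \<open>p\<close> need not be minimal.
\<close>

definition periodic_eigenvalue :: "real \<Rightarrow> real \<Rightarrow> real \<Rightarrow> real \<Rightarrow> complex \<Rightarrow> bool" where
  "periodic_eigenvalue R \<omega> c p lam \<longleftrightarrow>
     (\<exists>U V. twice_differentiable U \<and> twice_differentiable V \<and>
        (U, V) \<noteq> (\<lambda>x. 0, \<lambda>x. 0) \<and>
        (\<forall>x. U (x + p) = U x \<and> V (x + p) = V x) \<and>
        lin_op R \<omega> c (U, V) = (\<lambda>x. lam * U x, \<lambda>x. lam * V x))"

definition stokes_spectrally_stable :: "real \<Rightarrow> real \<Rightarrow> bool" where
  "stokes_spectrally_stable b p \<longleftrightarrow>
     (\<forall>lam. periodic_eigenvalue (stokes_R b) (stokes_omega b) (stokes_c b) p lam \<longrightarrow> Re lam = 0)"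

end

theory Submission
  imports Defs "HOL-Computational_Algebra.Fundamental_Theorem_Algebra"
begin

text \<open>
  For the Stokes wave the linearization has constant coefficients, and eliminating one unknown shows
  that \<open>U\<close> and \<open>V\<close> both solve
  \<open>((s \<partial> + \<lambda>)\<^sup>2 + (\<partial>\<^sup>2/2) (\<partial>\<^sup>2/2 + 2 b)) f = 0\<close> with \<open>s = sqrt (1 - b)\<close>.
  Peeling off linear factors \<open>\<partial> - r\<close> one at a time, a nonzero periodic solution must produce a
  characteristic root \<open>r\<close> for which \<open>exp (r x)\<close> is periodic; this avoids Fourier series.
  Hence \<open>r = \<i> \<kappa>\<close> with \<open>\<kappa> = 2 n / P\<close>, and the dispersion relation
  \<open>(\<lambda> + \<i> s \<kappa>)\<^sup>2 = - \<kappa>\<^sup>2 (\<kappa>\<^sup>2/4 - b)\<close> has a nonpositive right-hand side, as \<open>b \<le> 1 / P\<^sup>2\<close>.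
\<close>

lemma has_vector_derivative_periodic:
  fixes f f' :: "real \<Rightarrow> 'a::real_normed_vector"
  assumes deriv: "\<And>x. (f has_vector_derivative f' x) (at x)"
    and per: "\<And>x. f (x + L) = f x"
  shows "f' (x + L) = f' x"
proof -
  have "((f \<circ> (\<lambda>x. x + L)) has_vector_derivative 1 *\<^sub>R f' (x + L)) (at x)"
    by (rule vector_diff_chain_at) (auto intro!: derivative_eq_intros deriv)
  moreover have "f \<circ> (\<lambda>x. x + L) = f"
    using per by auto
  ultimately have "(f has_vector_derivative f' (x + L)) (at x)"
    by simp
  then show ?thesis
    using deriv by (rule vector_derivative_unique_at)
qed

text \<open>The integrating factor \<open>exp (- r * x)\<close> makes the product constant. This
  handles the case where applying \<partial> - \<open>r\<close> annihilates the function.\<close>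

lemma has_vector_derivative_exp_unique:
  fixes f :: "real \<Rightarrow> complex"
  assumes "\<And>x. (f has_vector_derivative r * f x) (at x)"
  shows "f x = f 0 * exp (r * of_real x)"
proof -
  have *: "((\<lambda>x. exp (- r * of_real x)) has_vector_derivative - r * exp (- r * of_real x)) (at x)"
    for x :: real
    by (rule has_vector_derivative_real_field)
      (auto intro!: derivative_eq_intros simp: algebra_simps)
  have "((\<lambda>x. f x * exp (- r * of_real x)) has_vector_derivative 0) (at x)" for x
    using has_vector_derivative_mult[OF assms *, of x] by (simp add: algebra_simps)
  then have "\<exists>c. \<forall>x. f x * exp (- r * of_real x) = c"
    using has_vector_derivative_zero_constant[of UNIV "\<lambda>x. f x * exp (- r * of_real x)"]
    by (metis UNIV_I convex_UNIV)
  then obtain c where c: "\<And>x. f x * exp (- r * of_real x) = c"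
    by blast
  have "f x * exp (- r * of_real x) = f 0"
    using c[of x] c[of 0] by simp
  then show ?thesis
    by (simp add: exp_minus field_simps)
qed

text \<open>Induction on the degree. Writing \<open>p\<close> as (X - \<open>r\<close>) times
  \<open>q\<close>, the function \<open>F' - r F\<close> is again periodic and solves the equation
  of \<open>q\<close>. If it is not identically zero, the induction hypothesis gives a root of
  \<open>q\<close>; otherwise \<open>F 0\<close> is a multiple of \<open>exp (r * x)\<close> and its
  period forces \<open>exp (r * L) = 1\<close>. In degree 0 a nonzero constant would annihilate
  \<open>F 0 x0\<close>.\<close>

lemma periodic_solution_characteristic_root:
  fixes F :: "nat \<Rightarrow> real \<Rightarrow> complex" and p :: "complex poly"
  assumes "\<And>n x. (F n has_vector_derivative F (Suc n) x) (at x)"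
    and "\<And>x. F 0 (x + L) = F 0 x"
    and "F 0 x0 \<noteq> 0"
    and "p \<noteq> 0"
    and "\<And>x. (\<Sum>i\<le>degree p. coeff p i * F i x) = 0"
  shows "\<exists>r. poly p r = 0 \<and> exp (r * of_real L) = 1"
  using assms
proof (induction "degree p" arbitrary: p F x0)
  case 0
  have "coeff p 0 * F 0 x0 = 0"
    using "0.prems"(5)[of x0] "0.hyps" by simp
  moreover have "coeff p 0 \<noteq> 0"
    using leading_coeff_neq_0[OF "0.prems"(4)] "0.hyps" by simp
  ultimately show ?case
    using "0.prems"(3) by simp
next
  case (Suc n)
  have "\<not> constant (poly p)"
    using Suc.hyps(2) by (simp add: constant_degree)
  then obtain r where r: "poly p r = 0"
    using fundamental_theorem_of_algebra by blast
  then obtain q where q: "p = [:- r, 1:] * q"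
    by (auto simp: poly_eq_0_iff_dvd)
  have "q \<noteq> 0"
    using Suc.prems(4) q by auto
  then have degq: "degree p = Suc (degree q)"
    unfolding q by (subst degree_mult_eq) auto
  define G where "G = (\<lambda>n x. F (Suc n) x - r * F n x)"
  have G_deriv: "(G n has_vector_derivative G (Suc n) x) (at x)" for n x
    unfolding G_def
    by (intro has_vector_derivative_diff has_vector_derivative_mult_right Suc.prems)
  have "F (Suc 0) (x + L) = F (Suc 0) x" for x
    using Suc.prems(1,2) by (rule has_vector_derivative_periodic)
  then have G_per: "G 0 (x + L) = G 0 x" for x
    using Suc.prems(2) by (simp add: G_def)
  have G_sol: "(\<Sum>i\<le>degree q. coeff q i * G i x) = 0" for x
  proof -
    \<comment> \<open>Since \<open>p\<close> is X \<open>q\<close> - \<open>r\<close>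
      \<open>q\<close>, both sums run up to \<open>Suc (degree q)\<close>: multiplication by X
      shifts the derivatives by one, and the top coefficient of \<open>q\<close> in the second sum
      is 0.\<close>
    have "(\<Sum>i\<le>degree p. coeff p i * F i x)
        = (\<Sum>i\<le>Suc (degree q). coeff (pCons 0 q) i * F i x)
          - r * (\<Sum>i\<le>Suc (degree q). coeff q i * F i x)"
      unfolding degq sum_distrib_left sum_subtractf[symmetric]
      by (intro sum.cong) (auto simp: q algebra_simps)
    also have "(\<Sum>i\<le>Suc (degree q). coeff (pCons 0 q) i * F i x)
        = (\<Sum>i\<le>degree q. coeff q i * F (Suc i) x)"
      by (subst sum.atMost_Suc_shift) simp
    also have "(\<Sum>i\<le>Suc (degree q). coeff q i * F i x) = (\<Sum>i\<le>degree q. coeff q i * F i x)"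
      by (simp add: coeff_eq_0)
    finally show ?thesis
      using Suc.prems(5)[of x]
      by (simp add: G_def sum_distrib_left sum_subtractf algebra_simps)
  qed
  show ?case
  proof (cases "\<exists>x1. G 0 x1 \<noteq> 0")
    case True
    then obtain x1 where "G 0 x1 \<noteq> 0" ..
    moreover have "n = degree q"
      using Suc.hyps(2) degq by simp
    ultimately have "\<exists>r. poly q r = 0 \<and> exp (r * of_real L) = 1"
      using Suc.hyps(1)[OF _ G_deriv G_per _ \<open>q \<noteq> 0\<close> G_sol] by blast
    then show ?thesis
      by (auto simp: q)
  next
    case False
    then have "F (Suc 0) x = r * F 0 x" for x
      by (simp add: G_def)
    then have "(F 0 has_vector_derivative r * F 0 x) (at x)" for x
      using Suc.prems(1)[of 0 x] by simp
    then have F0: "F 0 x = F 0 0 * exp (r * of_real x)" for x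
      by (rule has_vector_derivative_exp_unique)
    have "F 0 0 \<noteq> 0"
      using Suc.prems(3) F0[of x0] by auto
    moreover have "F 0 0 * exp (r * of_real L) = F 0 0"
      using Suc.prems(2)[of 0] F0[of L] by simp
    ultimately show ?thesis
      using r by auto
  qed
qed

text \<open>
  \<open>stokes_jet s b lam n (U x, D U x, V x, D V x)\<close> is the pair of \<open>n\<close>-th derivatives of
  an eigenfunction: the recursion is the eigenvalue equation solved for \<open>U''\<close> and \<open>V''\<close>.
\<close>

fun stokes_jet :: "complex \<Rightarrow> complex \<Rightarrow> complex \<Rightarrow> nat \<Rightarrow>
    complex \<times> complex \<times> complex \<times> complex \<Rightarrow> complex \<times> complex" where
  "stokes_jet s b lam 0 (u, u', v, v') = (u, v)"
| "stokes_jet s b lam (Suc 0) (u, u', v, v') = (u', v')"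
| "stokes_jet s b lam (Suc (Suc n)) y =
    (2 * lam * snd (stokes_jet s b lam n y) + 2 * s * snd (stokes_jet s b lam (Suc n) y)
       - 4 * b * fst (stokes_jet s b lam n y),
     - 2 * lam * fst (stokes_jet s b lam n y) - 2 * s * fst (stokes_jet s b lam (Suc n) y))"

text \<open>Differentiation commutes with the recursion because its coefficients are constant. The
  recursion reaches back two steps, so there are two base cases, of which the second uses the
  differential equations.\<close>

lemma stokes_jet_derivative:
  assumes U: "\<And>x. (U has_vector_derivative U' x) (at x)"
    and V: "\<And>x. (V has_vector_derivative V' x) (at x)"
    and U': "\<And>x. (U' has_vector_derivative 2 * lam * V x + 2 * s * V' x - 4 * b * U x) (at x)"
    and V': "\<And>x. (V' has_vector_derivative - 2 * lam * U x - 2 * s * U' x) (at x)"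
  defines "J \<equiv> \<lambda>n x. stokes_jet s b lam n (U x, U' x, V x, V' x)"
  shows "((\<lambda>x. fst (J n x)) has_vector_derivative fst (J (Suc n) x)) (at x)
       \<and> ((\<lambda>x. snd (J n x)) has_vector_derivative snd (J (Suc n) x)) (at x)"
proof (induction n rule: induct_nat_012)
  case 0
  show ?case
    using U V by (simp add: J_def)
next
  case 1
  show ?case
    using U' V' by (simp add: J_def)
next
  case (ge2 n)
  then show ?case
    unfolding J_def stokes_jet.simps(3) fst_conv snd_conv
    by (intro conjI has_vector_derivative_diff has_vector_derivative_add
        has_vector_derivative_mult_right) auto
qed

lemma stokes_dispersion:
  fixes lam r :: complex and s b :: real and P :: nat and n :: int
  assumes "P > 0" "b \<le> 1 / (real P)\<^sup>2"
    and r: "Re r = 0" "Im r * real P = 2 * of_int n"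
    and disp: "(s * r + lam)\<^sup>2 + r\<^sup>2 / 2 * (r\<^sup>2 / 2 + 2 * of_real b) = 0"
  shows "Re lam = 0"
proof -
  define k where "k = Im r"
  have rk: "r = \<i> * k"
    using r by (simp add: k_def complex_eq_iff)
  define m where "m = k\<^sup>2 * (k\<^sup>2 / 4 - b)"
  \<comment> \<open>The mode \<open>n = 0\<close> gives \<open>k = 0\<close>; every other mode has
    \<open>k\<^sup>2 / 4 = n\<^sup>2 / P\<^sup>2\<close>, which is at least
    \<open>1 / P\<^sup>2\<close> and hence at least \<open>b\<close>.\<close>
  have "m \<ge> 0"
  proof (cases "n = 0")
    case True
    then show ?thesis
      using r \<open>P > 0\<close> by (simp add: m_def k_def)
  next
    case False
    then have "1 \<le> n\<^sup>2"
      by (simp add: int_one_le_iff_zero_less)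
    then have "1 \<le> (real_of_int n)\<^sup>2"
      by (metis of_int_1_le_iff of_int_power)
    moreover have "k = 2 * of_int n / real P"
      using r \<open>P > 0\<close> by (simp add: k_def field_simps)
    ultimately have "1 / (real P)\<^sup>2 \<le> k\<^sup>2 / 4"
      by (simp add: power_divide power_mult_distrib divide_right_mono)
    then show ?thesis
      using assms(2) by (simp add: m_def)
  qed
  have "(lam + \<i> * (s * k))\<^sup>2 = - complex_of_real m"
    using disp unfolding rk m_def by (simp add: power2_eq_square field_simps)
  \<comment> \<open>A complex number whose square is a nonpositive real is purely imaginary, and the
    shift \<open>\<i> * (s * k)\<close> does not change the real part.\<close>
  then have "(Re lam)\<^sup>2 - (Im lam + s * k)\<^sup>2 = - m" "Re lam * (Im lam + s * k) = 0"
    by (auto simp: complex_eq_iff power2_eq_square)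
  then have "(Re lam)\<^sup>2 = - m \<or> Re lam = 0"
    by auto
  then show ?thesis
  proof
    assume "(Re lam)\<^sup>2 = - m"
    then have "(Re lam)\<^sup>2 \<le> 0"
      using \<open>m \<ge> 0\<close> by linarith
    then show ?thesis
      by simp
  qed
qed

theorem theorem9p1:
  fixes P :: nat and b :: real
  assumes "P > 0" and "0 < b" and "b \<le> 1" and "b \<le> 1 / (real P)^2"
  shows "stokes_spectrally_stable b (real P * pi)"
  unfolding stokes_spectrally_stable_def
proof (intro allI impI)
  fix lam
  define s where "s = sqrt (1 - b)"
  have s2: "s\<^sup>2 = 1 - b"
    using assms by (simp add: s_def)
  assume "periodic_eigenvalue (stokes_R b) (stokes_omega b) (stokes_c b) (real P * pi) lam"
  then obtain U V where
    diff: "twice_differentiable U" "twice_differentiable V"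
    and nz: "(U, V) \<noteq> (\<lambda>x. 0, \<lambda>x. 0)"
    and per: "\<And>x. U (x + real P * pi) = U x" "\<And>x. V (x + real P * pi) = V x"
    and eig: "lin_op (stokes_R b) (stokes_omega b) (stokes_c b) (U, V)
                = (\<lambda>x. lam * U x, \<lambda>x. lam * V x)"
    unfolding periodic_eigenvalue_def by blast
  have R2: "(stokes_R b)\<^sup>2 = b"
    using assms by (simp add: stokes_R_def)
  then have R4: "(stokes_R b) ^ 4 = b\<^sup>2"
    using power_mult[of "stokes_R b" 2 2] by simp
  have c: "stokes_c b / b = s" "(stokes_c b)\<^sup>2 / (2 * b\<^sup>2) = (1 - b) / 2"
    using assms s2 by (auto simp: stokes_c_def s_def power_mult_distrib)
  \<comment> \<open>The choice of frequency cancels the zero-order term of \<open>L_minus\<close>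
    and leaves \<open>- 2 * b\<close> in \<open>L_plus\<close>.\<close>
  have Lm: "- b - stokes_omega b + (1 - b) / 2 = 0"
    and Lp: "- (3 * b) - stokes_omega b + (1 - b) / 2 = - 2 * b"
    by (simp_all add: stokes_omega_def field_simps)
  have V'': "D (D V) x = - 2 * lam * U x - 2 * of_real s * D U x" for x
  proof -
    have *: "lam * U x = - (s * D U x) - 1 / 2 * D (D V) x"
      using fun_cong[OF arg_cong[OF eig, of fst], of x]
      unfolding lin_op_def S_op_def L_minus_def R2 R4 c Lm by simp
    show ?thesis
      unfolding mult.assoc * by (simp add: algebra_simps)
  qed
  have U'': "D (D U) x = 2 * lam * V x + 2 * of_real s * D V x - 4 * of_real b * U x" for x
  proof -
    have *: "lam * V x = 1 / 2 * D (D U) x + 2 * (b * U x) - s * D V x"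
      using fun_cong[OF arg_cong[OF eig, of snd], of x]
      unfolding lin_op_def S_op_def L_plus_def R2 R4 c Lp by (simp add: algebra_simps)
    show ?thesis
      unfolding mult.assoc * by (simp add: algebra_simps)
  qed
  define J where "J = (\<lambda>n x. stokes_jet s b lam n (U x, D U x, V x, D V x))"
  have deriv: "((\<lambda>x. fst (J n x)) has_vector_derivative fst (J (Suc n) x)) (at x)
      \<and> ((\<lambda>x. snd (J n x)) has_vector_derivative snd (J (Suc n) x)) (at x)" for n x
    unfolding J_def
  proof (rule stokes_jet_derivative[where U = U and U' = "D U" and V = V and V' = "D V"])
    show "(U has_vector_derivative D U x) (at x)" "(V has_vector_derivative D V x) (at x)" for x
      using diff by (auto simp: twice_differentiable_def vector_derivative_works[symmetric])
    show "(D U has_vector_derivative 2 * lam * V x + 2 * of_real s * D V x - 4 * of_real b * U x) (at x)"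
      "(D V has_vector_derivative - 2 * lam * U x - 2 * of_real s * D U x) (at x)" for x
      using diff unfolding U''[symmetric] V''[symmetric]
      by (auto simp: twice_differentiable_def vector_derivative_works[symmetric])
  qed
  \<comment> \<open>This is the expanded determinant of the eigenvalue system with \<partial>
    replaced by X: \<open>(s X + lam)\<^sup>2 + (X\<^sup>2/2) (X\<^sup>2/2 + 2 b)\<close>.\<close>
  define p where "p = [:lam\<^sup>2, 2 * lam * s, s\<^sup>2 + b, 0, 1 / 4:]"
  have "p \<noteq> 0" "degree p = 4"
    by (simp_all add: p_def)
  \<comment> \<open>Once the jets up to order 4 are unfolded, this is a polynomial identity in
    \<open>U\<close>, \<open>V\<close> and their first derivatives, as in Cayley-Hamilton.\<close>
  have sol: "(\<Sum>i\<le>degree p. coeff p i * fst (J i x)) = 0"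
    "(\<Sum>i\<le>degree p. coeff p i * snd (J i x)) = 0" for x
    unfolding \<open>degree p = 4\<close>
    by (simp_all add: p_def J_def eval_nat_numeral atMost_Suc algebra_simps)
  have J0: "fst (J 0 x) = U x" "snd (J 0 x) = V x" for x
    by (simp_all add: J_def)
  have "\<exists>r. poly p r = 0 \<and> exp (r * of_real (real P * pi)) = 1"
  proof (cases "\<exists>x. U x \<noteq> 0")
    case True
    then obtain x0 where "U x0 \<noteq> 0" ..
    then show ?thesis
      by (intro periodic_solution_characteristic_root[where F = "\<lambda>n x. fst (J n x)"]
          conjunct1[OF deriv] \<open>p \<noteq> 0\<close> sol) (simp_all only: J0 per not_False_eq_True)
  next
    case False
    then obtain x0 where "V x0 \<noteq> 0"
      using nz by auto
    then show ?thesis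
      by (intro periodic_solution_characteristic_root[where F = "\<lambda>n x. snd (J n x)"]
          conjunct2[OF deriv] \<open>p \<noteq> 0\<close> sol) (simp_all only: J0 per not_False_eq_True)
  qed
  then obtain r where r: "poly p r = 0" "exp (r * of_real (real P * pi)) = 1"
    by blast
  \<comment> \<open>The exponent is an integer multiple of \<open>2 * pi * \<i>\<close>, and
    \<open>pi\<close> cancels against the period.\<close>
  from r(2) obtain n :: int where n: "Re r = 0" "Im r * real P = 2 * of_int n"
    using \<open>P > 0\<close> by (auto simp: exp_eq_1)
  have "poly p r = (s * r + lam)\<^sup>2 + r\<^sup>2 / 2 * (r\<^sup>2 / 2 + 2 * of_real b)"
    unfolding p_def poly_pCons poly_0 of_real_add of_real_power
    by (simp add: power2_eq_square distrib_left distrib_right ac_simps)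
  with r(1) have "(s * r + lam)\<^sup>2 + r\<^sup>2 / 2 * (r\<^sup>2 / 2 + 2 * of_real b) = 0"
    by metis
  with assms(1,4) n show "Re lam = 0"
    by (rule stokes_dispersion)
qed

end
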